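(* Let $(\mathsf{C},J)$ be a site, where $\mathsf{C}$ is a category with pullbacks, let $\mathsf{D}$ be a category with pullbacks, and let $\Gamma:\mathsf{C}^{\mathrm{op}}\to\mathsf{D}$ be a $\mathsf{D}$-valued sheaf on $(\mathsf{C},J)$. Then $\Gamma$ is a gleaf in a unique way (i.e. there is exactly one gluing operation $g$ such that $(\Gamma,g)$ is a gleaf) with respect to the bicoverings given by those cospans $a\to c\leftarrow b$ in $\mathsf{C}$ whose legs are monomorphisms and which generate a $J$-covering sieve on $c$.
   Context: **Sheaves.** A functor $\Gamma:\mathsf{C}^{\mathrm{op}}\to\mathsf{D}$ is a sheaf on $(\mathsf{C},J)$ if for every object $c$ and every $J$-covering sieve $S$ on $c$, restriction exhibits $\Gamma(c)$ as the limit in $\mathsf{D}$ of the diagram $(x\to c)\mapsto\Gamma(x)$ indexed by $S$. **Morphisms of bicoverings.** The cospans named in the claim are called bicoverings; they form a system of bicoverings on $\mathsf{C}$: the legs are monomorphisms and can be completed to pullback squares, the cospans $a=a=a$ are included, the collection is stable under composition (if $a\to c\leftarrow b$ and $a'\to a\leftarrow a\times_c b$ are bicoverings, so is $a'\to c\leftarrow b$) and stable under pullback along any $c'\to c$. The two legs are not distinguished. A morphism of bicoverings from $a'\to c'\leftarrow b'$ to $a\to c\leftarrow b$ consists of $q_a:a'\to a$, $q_b:b'\to b$, $q_c:c'\to c$ commuting with the legs, such that the induced map $a'\times_{c'}b'\to a\times_c b$ has a right inverse. **Gleaves.** A gleaf on $\mathsf{C}$ with values in $\mathsf{D}$ is a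 functor $\Gamma:\mathsf{C}^{\mathrm{op}}\to\mathsf{D}$ together with a gluing operation, i.e. a morphism $g:\Gamma(a)\times_{\Gamma(a\times_c b)}\Gamma(b)\to\Gamma(c)$ in $\mathsf{D}$ for every bicovering $a\to c\leftarrow b$ (independent, up to swapping arguments, of the order of the legs), such that: 1. (Identity) for a bicovering $a=a\leftarrow b$, $g=\pi_1:\Gamma(a)\times_{\Gamma(b)}\Gamma(b)\to\Gamma(a)$; for a bicovering $a\to b=b$, $g=\pi_2:\Gamma(a)\times_{\Gamma(a)}\Gamma(b)\to\Gamma(b)$. 2. (Back-and-forth) given bicoverings $a\to c\leftarrow b$ and $a'\to a\leftarrow a\times_c b$, the composite $\Gamma(a')\times_{\Gamma(a'\times_c b)}\Gamma(b)\xrightarrow{g}\Gamma(c)\to\Gamma(a)\times_{\Gamma(a\times_c b)}\Gamma(b)\xrightarrow{g}\Gamma(c)$ (middle arrow: restriction) equals $g:\Gamma(a')\times_{\Gamma(a'\times_c b)}\Gamma(b)\to\Gamma(c)$. 3. (Partial naturality) for every morphism of bicoverings $(q_a,q_b,q_c)$ from $a'\to c'\leftarrow b'$ to $a\to c\leftarrow b$, $\Gamma(q_c)\circ g=g\circ(\Gamma(q_a)\times\Gamma(q_b))$ as morphisms $\Gamma(a)\times_{\Gamma(a\times_c b)}\Gamma(b)\to\Gamma(c')$. *)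

theory Defs
  imports Main
begin

section \<open>Categories and functors\<close>

text \<open>
  A category is given by carrier sets of objects and arrows over arbitrary types; operations
  outside these carriers are unconstrained. Composition is written in applicative order,
  \<open>g \<cdot>\<^bsub>C\<^esub> f\<close> meaning ``first \<open>f\<close>, then \<open>g\<close>''.
\<close>

record ('o, 'm) cat =
  Obj :: "'o set"
  Arr :: "'m set"
  Dom :: "'m \<Rightarrow> 'o"
  Cod :: "'m \<Rightarrow> 'o"
  Ident :: "'o \<Rightarrow> 'm"
  Comp :: "'m \<Rightarrow> 'm \<Rightarrow> 'm" (infixl "\<cdot>\<index>" 70)

definition hom :: "('o, 'm) cat \<Rightarrow> 'o \<Rightarrow> 'o \<Rightarrow> 'm set" where
  "hom C a b = {f \<in> Arr C. Dom C f = a \<and> Cod C f = b}"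

locale category =
  fixes C :: "('o, 'm) cat" (structure)
  assumes dom_obj: "f \<in> Arr C \<Longrightarrow> Dom C f \<in> Obj C"
    and cod_obj: "f \<in> Arr C \<Longrightarrow> Cod C f \<in> Obj C"
    and ident_hom: "a \<in> Obj C \<Longrightarrow> Ident C a \<in> hom C a a"
    and comp_hom: "\<lbrakk>f \<in> hom C a b; g \<in> hom C b c\<rbrakk> \<Longrightarrow> g \<cdot> f \<in> hom C a c"
    and ident_right: "f \<in> hom C a b \<Longrightarrow> f \<cdot> Ident C a = f"
    and ident_left: "f \<in> hom C a b \<Longrightarrow> Ident C b \<cdot> f = f"
    and comp_assoc: "\<lbrakk>f \<in> hom C a b; g \<in> hom C b c; h \<in> hom C c d\<rbrakk>
      \<Longrightarrow> (h \<cdot> g) \<cdot> f = h \<cdot> (g \<cdot> f)"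

definition op_cat :: "('o, 'm) cat \<Rightarrow> ('o, 'm) cat" where
  "op_cat C = \<lparr>Obj = Obj C, Arr = Arr C, Dom = Cod C, Cod = Dom C, Ident = Ident C,
     Comp = (\<lambda>g f. f \<cdot>\<^bsub>C\<^esub> g)\<rparr>"

lemma category_op_cat:
  assumes "category C"
  shows "category (op_cat C)"
proof -
  interpret category C by fact
  have [simp]: "hom (op_cat C) a b = hom C b a" for a b
    by (auto simp: hom_def op_cat_def)
  show ?thesis
    by unfold_locales
      (simp_all, auto simp: op_cat_def dom_obj cod_obj ident_hom ident_left ident_right
        comp_assoc intro: comp_hom)
qed

record ('o1, 'm1, 'o2, 'm2) functor_data =
  on_obj :: "'o1 \<Rightarrow> 'o2"
  on_arr :: "'m1 \<Rightarrow> 'm2"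

locale is_functor = A: category A + B: category B
  for A :: "('o1, 'm1) cat" and B :: "('o2, 'm2) cat"
    and F :: "('o1, 'm1, 'o2, 'm2) functor_data" +
  assumes on_obj: "a \<in> Obj A \<Longrightarrow> on_obj F a \<in> Obj B"
    and on_arr: "f \<in> hom A a b \<Longrightarrow> on_arr F f \<in> hom B (on_obj F a) (on_obj F b)"
    and on_ident: "a \<in> Obj A \<Longrightarrow> on_arr F (Ident A a) = Ident B (on_obj F a)"
    and on_comp: "\<lbrakk>f \<in> hom A a b; g \<in> hom A b c\<rbrakk>
      \<Longrightarrow> on_arr F (g \<cdot>\<^bsub>A\<^esub> f) = on_arr F g \<cdot>\<^bsub>B\<^esub> on_arr F f"

definition is_mono :: "('o, 'm) cat \<Rightarrow> 'm \<Rightarrow> bool" where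
  "is_mono C f \<longleftrightarrow> f \<in> Arr C \<and>
     (\<forall>a. \<forall>x \<in> hom C a (Dom C f). \<forall>y \<in> hom C a (Dom C f).
        f \<cdot>\<^bsub>C\<^esub> x = f \<cdot>\<^bsub>C\<^esub> y \<longrightarrow> x = y)"

definition cospan :: "('o, 'm) cat \<Rightarrow> 'm \<Rightarrow> 'm \<Rightarrow> bool" where
  "cospan C f h \<longleftrightarrow> f \<in> Arr C \<and> h \<in> Arr C \<and> Cod C f = Cod C h"


section \<open>Limits and pullbacks\<close>

definition is_cone :: "('i, 'k) cat \<Rightarrow> ('o, 'm) cat \<Rightarrow> ('i, 'k, 'o, 'm) functor_data
    \<Rightarrow> 'o \<Rightarrow> ('i \<Rightarrow> 'm) \<Rightarrow> bool" where
  "is_cone I D F x \<pi> \<longleftrightarrow> x \<in> Obj D \<and>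
     (\<forall>i \<in> Obj I. \<pi> i \<in> hom D x (on_obj F i)) \<and>
     (\<forall>u \<in> Arr I. on_arr F u \<cdot>\<^bsub>D\<^esub> \<pi> (Dom I u) = \<pi> (Cod I u))"

definition is_limit :: "('i, 'k) cat \<Rightarrow> ('o, 'm) cat \<Rightarrow> ('i, 'k, 'o, 'm) functor_data
    \<Rightarrow> 'o \<Rightarrow> ('i \<Rightarrow> 'm) \<Rightarrow> bool" where
  "is_limit I D F x \<pi> \<longleftrightarrow> is_cone I D F x \<pi> \<and>
     (\<forall>y \<rho>. is_cone I D F y \<rho> \<longrightarrow>
        (\<exists>!w. w \<in> hom D y x \<and> (\<forall>i \<in> Obj I. \<pi> i \<cdot>\<^bsub>D\<^esub> w = \<rho> i)))"

definition is_pullback :: "('o, 'm) cat \<Rightarrow> 'm \<Rightarrow> 'm \<Rightarrow> 'm \<Rightarrow> 'm \<Rightarrow> bool" where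
  "is_pullback C f h p q \<longleftrightarrow> cospan C f h \<and>
     p \<in> Arr C \<and> q \<in> Arr C \<and> Dom C p = Dom C q \<and> Cod C p = Dom C f \<and> Cod C q = Dom C h \<and>
     f \<cdot>\<^bsub>C\<^esub> p = h \<cdot>\<^bsub>C\<^esub> q \<and>
     (\<forall>z. \<forall>x \<in> hom C z (Dom C f). \<forall>y \<in> hom C z (Dom C h).
        f \<cdot>\<^bsub>C\<^esub> x = h \<cdot>\<^bsub>C\<^esub> y \<longrightarrow>
        (\<exists>!w. w \<in> hom C z (Dom C p) \<and> p \<cdot>\<^bsub>C\<^esub> w = x \<and> q \<cdot>\<^bsub>C\<^esub> w = y))"

text \<open>
  Every cospan has a pullback, and \<open>PB f h\<close> is the pair of projections that the notation
  \<open>a \<times>\<^sub>c b\<close> refers to. Nothing is assumed about the choice beyond the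
  universal property; in particular \<open>a \<times>\<^sub>a b\<close> need not be \<open>b\<close> itself, nor \<open>b \<times>\<^sub>c a\<close> be equal
  to \<open>a \<times>\<^sub>c b\<close>.
\<close>

locale category_with_pullbacks = category C for C :: "('o, 'm) cat" +
  fixes PB :: "'m \<Rightarrow> 'm \<Rightarrow> 'm \<times> 'm"
  assumes pullback: "cospan C f h \<Longrightarrow> is_pullback C f h (fst (PB f h)) (snd (PB f h))"

text \<open>
  The arrow into a pullback with projections \<open>pq\<close> whose components are \<open>x\<close> and \<open>y\<close>.
\<close>

definition induced :: "('o, 'm) cat \<Rightarrow> 'm \<times> 'm \<Rightarrow> 'm \<Rightarrow> 'm \<Rightarrow> 'm" where
  "induced C pq x y = (THE w. w \<in> hom C (Dom C x) (Dom C (fst pq)) \<and>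
     fst pq \<cdot>\<^bsub>C\<^esub> w = x \<and> snd pq \<cdot>\<^bsub>C\<^esub> w = y)"


section \<open>Sites and sheaves\<close>

definition is_sieve :: "('o, 'm) cat \<Rightarrow> 'o \<Rightarrow> 'm set \<Rightarrow> bool" where
  "is_sieve C c S \<longleftrightarrow> S \<subseteq> {f \<in> Arr C. Cod C f = c} \<and>
     (\<forall>f \<in> S. \<forall>u \<in> Arr C. Cod C u = Dom C f \<longrightarrow> f \<cdot>\<^bsub>C\<^esub> u \<in> S)"

definition maximal_sieve :: "('o, 'm) cat \<Rightarrow> 'o \<Rightarrow> 'm set" where
  "maximal_sieve C c = {f \<in> Arr C. Cod C f = c}"

definition pullback_sieve :: "('o, 'm) cat \<Rightarrow> 'm \<Rightarrow> 'm set \<Rightarrow> 'm set" where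
  "pullback_sieve C q S = {u \<in> Arr C. Cod C u = Dom C q \<and> q \<cdot>\<^bsub>C\<^esub> u \<in> S}"

definition generated_sieve :: "('o, 'm) cat \<Rightarrow> 'm set \<Rightarrow> 'm set" where
  "generated_sieve C R = {r \<cdot>\<^bsub>C\<^esub> u | r u. r \<in> R \<and> u \<in> Arr C \<and> Cod C u = Dom C r}"

locale site = category C for C :: "('o, 'm) cat" +
  fixes J :: "'o \<Rightarrow> 'm set set"
  assumes sieve: "\<lbrakk>c \<in> Obj C; S \<in> J c\<rbrakk> \<Longrightarrow> is_sieve C c S"
    and maximal: "c \<in> Obj C \<Longrightarrow> maximal_sieve C c \<in> J c"
    and stable: "\<lbrakk>c \<in> Obj C; S \<in> J c; q \<in> hom C b c\<rbrakk> \<Longrightarrow> pullback_sieve C q S \<in> J b"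
    and transitive: "\<lbrakk>c \<in> Obj C; S \<in> J c; is_sieve C c R;
      \<And>f. f \<in> S \<Longrightarrow> pullback_sieve C f R \<in> J (Dom C f)\<rbrakk> \<Longrightarrow> R \<in> J c"

text \<open>
  A sieve as a full subcategory of the slice category: the triple \<open>(f, u, g)\<close> is the arrow
  from \<open>f\<close> to \<open>g\<close> given by a \<open>u\<close> with \<open>g \<cdot> u = f\<close>.
\<close>

definition sieve_cat :: "('o, 'm) cat \<Rightarrow> 'm set \<Rightarrow> ('m, 'm \<times> 'm \<times> 'm) cat" where
  "sieve_cat C S = \<lparr>
     Obj = S,
     Arr = {(f, u, g). f \<in> S \<and> g \<in> S \<and> u \<in> hom C (Dom C f) (Dom C g) \<and> g \<cdot>\<^bsub>C\<^esub> u = f},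
     Dom = (\<lambda>(f, u, g). f),
     Cod = (\<lambda>(f, u, g). g),
     Ident = (\<lambda>f. (f, Ident C (Dom C f), f)),
     Comp = (\<lambda>(f', v, g') (f, u, g). (f, v \<cdot>\<^bsub>C\<^esub> u, g'))\<rparr>"

definition sieve_diagram :: "('oc, 'mc) cat \<Rightarrow> ('oc, 'mc, 'od, 'md) functor_data
    \<Rightarrow> ('mc, 'mc \<times> 'mc \<times> 'mc, 'od, 'md) functor_data" where
  "sieve_diagram C \<Gamma> = \<lparr>on_obj = (\<lambda>f. on_obj \<Gamma> (Dom C f)), on_arr = (\<lambda>(f, u, g). on_arr \<Gamma> u)\<rparr>"

lemma (in category) category_sieve_cat:
  assumes "is_sieve C c S"
  shows "category (sieve_cat C S)"
proof -
  have arr: "f \<in> hom C (Dom C f) c" if "f \<in> S" for f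
    using that assms by (auto simp: is_sieve_def hom_def)
  have id: "f \<cdot> Ident C (Dom C f) = f" "Ident C (Dom C f) \<in> hom C (Dom C f) (Dom C f)"
    if "f \<in> S" for f
    using arr[OF that] ident_right ident_hom dom_obj by (auto simp: hom_def)
  show ?thesis
  proof
    fix x y z f g
    assume "f \<in> hom (sieve_cat C S) x y" "g \<in> hom (sieve_cat C S) y z"
    then obtain u v where *: "f = (x, u, y)" "g = (y, v, z)" "x \<in> S" "y \<in> S" "z \<in> S"
      "u \<in> hom C (Dom C x) (Dom C y)" "y \<cdot> u = x" "v \<in> hom C (Dom C y) (Dom C z)" "z \<cdot> v = y"
      by (auto simp: sieve_cat_def hom_def)
    have "z \<cdot> (v \<cdot> u) = x"
      using comp_assoc[OF *(6,8) arr[OF *(5)]] * by simp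
    then show "g \<cdot>\<^bsub>sieve_cat C S\<^esub> f \<in> hom (sieve_cat C S) x z"
      using * comp_hom[OF *(6,8)] by (auto simp: sieve_cat_def hom_def)
  qed (auto simp: sieve_cat_def id hom_def intro!: ident_right ident_left comp_assoc
        dest: id(2)[unfolded hom_def])
qed

lemma is_functor_sieve_diagram:
  assumes "is_functor (op_cat C) D \<Gamma>" "category C" "is_sieve C c S"
  shows "is_functor (op_cat (sieve_cat C S)) D (sieve_diagram C \<Gamma>)"
proof -
  interpret is_functor "op_cat C" D \<Gamma> by fact
  interpret C: category C by fact
  have arr: "f \<in> Arr C" "Dom C f \<in> Obj C" if "f \<in> S" for f
    using that assms(3) C.dom_obj by (auto simp: is_sieve_def)
  have hom_op: "hom (op_cat C) a b = hom C b a" for a b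
    by (auto simp: hom_def op_cat_def)
  show ?thesis
  proof (intro is_functor.intro is_functor_axioms.intro)
    show "category (op_cat (sieve_cat C S))"
      using assms(3) by (intro category_op_cat C.category_sieve_cat)
    fix x y z f g
    assume "f \<in> hom (op_cat (sieve_cat C S)) x y" "g \<in> hom (op_cat (sieve_cat C S)) y z"
    then obtain u v where *: "f = (y, u, x)" "g = (z, v, y)"
      "u \<in> hom C (Dom C y) (Dom C x)" "v \<in> hom C (Dom C z) (Dom C y)"
      by (auto simp: sieve_cat_def op_cat_def hom_def)
    show "on_arr (sieve_diagram C \<Gamma>) (g \<cdot>\<^bsub>op_cat (sieve_cat C S)\<^esub> f)
      = on_arr (sieve_diagram C \<Gamma>) g \<cdot>\<^bsub>D\<^esub> on_arr (sieve_diagram C \<Gamma>) f"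
      using on_comp[of u "Dom C x" "Dom C y" v "Dom C z"] *
      by (simp add: sieve_diagram_def sieve_cat_def op_cat_def hom_def)
  next
    fix f x y
    assume "f \<in> hom (op_cat (sieve_cat C S)) x y"
    then obtain u where "f = (y, u, x)" "u \<in> hom C (Dom C y) (Dom C x)"
      by (auto simp: sieve_cat_def op_cat_def hom_def)
    then show "on_arr (sieve_diagram C \<Gamma>) f
      \<in> hom D (on_obj (sieve_diagram C \<Gamma>) x) (on_obj (sieve_diagram C \<Gamma>) y)"
      using on_arr[of u "Dom C x" "Dom C y"] by (simp add: sieve_diagram_def hom_op)
  next
    fix f assume "f \<in> Obj (op_cat (sieve_cat C S))"
    then show "on_obj (sieve_diagram C \<Gamma>) f \<in> Obj D"
      "on_arr (sieve_diagram C \<Gamma>) (Ident (op_cat (sieve_cat C S)) f)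
        = Ident D (on_obj (sieve_diagram C \<Gamma>) f)"
      using on_obj[of "Dom C f"] on_ident[of "Dom C f"] arr[of f]
      by (simp_all add: sieve_diagram_def sieve_cat_def op_cat_def)
  qed unfold_locales
qed

locale sheaf = site C J + is_functor "op_cat C" D \<Gamma>
  for C :: "('oc, 'mc) cat" and J :: "'oc \<Rightarrow> 'mc set set"
    and D :: "('od, 'md) cat" and \<Gamma> :: "('oc, 'mc, 'od, 'md) functor_data" +
  assumes restriction_limit: "\<lbrakk>c \<in> Obj C; S \<in> J c\<rbrakk> \<Longrightarrow>
    is_limit (op_cat (sieve_cat C S)) D (sieve_diagram C \<Gamma>) (on_obj \<Gamma> c) (on_arr \<Gamma>)"


section \<open>Bicoverings\<close>

text \<open>
  \<open>K f h\<close> says that the cospan with legs \<open>f : a \<rightarrow> c\<close> and \<open>h : b \<rightarrow> c\<close> is a bicovering.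
  The projection \<open>p\<close> of a pullback square of \<open>f\<close> and \<open>h\<close> is the leg \<open>a \<times>\<^sub>c b \<rightarrow> a\<close>.
\<close>

locale bicovering_system = category C for C :: "('o, 'm) cat" +
  fixes K :: "'m \<Rightarrow> 'm \<Rightarrow> bool"
  assumes bicovering_cospan: "K f h \<Longrightarrow> cospan C f h"
    and bicovering_mono: "K f h \<Longrightarrow> is_mono C f \<and> is_mono C h"
    and bicovering_pullback: "\<lbrakk>K f h; cospan C f q\<rbrakk> \<Longrightarrow> \<exists>p p'. is_pullback C f q p p'"
    and bicovering_sym: "K f h \<Longrightarrow> K h f"
    and bicovering_ident: "a \<in> Obj C \<Longrightarrow> K (Ident C a) (Ident C a)"
    and bicovering_comp: "\<lbrakk>K f h; is_pullback C f h p p'; K k p\<rbrakk> \<Longrightarrow> K (f \<cdot>\<^bsub>C\<^esub> k) h"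
    and bicovering_stable: "\<lbrakk>K f h; is_pullback C q f f' r; is_pullback C q h h' s\<rbrakk> \<Longrightarrow> K f' h'"

definition covering_cospan :: "('o, 'm) cat \<Rightarrow> ('o \<Rightarrow> 'm set set) \<Rightarrow> 'm \<Rightarrow> 'm \<Rightarrow> bool" where
  "covering_cospan C J f h \<longleftrightarrow> cospan C f h \<and> is_mono C f \<and> is_mono C h \<and>
     generated_sieve C {f, h} \<in> J (Cod C f)"

text \<open>
  A morphism of bicoverings from \<open>(f', h')\<close> to \<open>(f, h)\<close>.
\<close>

definition bicovering_morphism :: "('o, 'm) cat \<Rightarrow> ('m \<Rightarrow> 'm \<Rightarrow> 'm \<times> 'm)
    \<Rightarrow> 'm \<times> 'm \<Rightarrow> 'm \<times> 'm \<Rightarrow> 'm \<Rightarrow> 'm \<Rightarrow> 'm \<Rightarrow> bool" where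
  "bicovering_morphism C PB = (\<lambda>(f', h') (f, h) qa qb qc.
     qa \<in> hom C (Dom C f') (Dom C f) \<and>
     qb \<in> hom C (Dom C h') (Dom C h) \<and>
     qc \<in> hom C (Cod C f') (Cod C f) \<and>
     f \<cdot>\<^bsub>C\<^esub> qa = qc \<cdot>\<^bsub>C\<^esub> f' \<and> h \<cdot>\<^bsub>C\<^esub> qb = qc \<cdot>\<^bsub>C\<^esub> h' \<and>
     (let (p, p') = PB f h; (r, r') = PB f' h' in
      \<exists>s \<in> hom C (Dom C p) (Dom C r).
        induced C (p, p') (qa \<cdot>\<^bsub>C\<^esub> r) (qb \<cdot>\<^bsub>C\<^esub> r') \<cdot>\<^bsub>C\<^esub> s = Ident C (Dom C p)))"


section \<open>Gleaves\<close>

locale gluing_context =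
  CP: category_with_pullbacks C PC + DP: category_with_pullbacks D PD +
  bicovering_system C K + is_functor "op_cat C" D \<Gamma>
  for C :: "('oc, 'mc) cat" and PC :: "'mc \<Rightarrow> 'mc \<Rightarrow> 'mc \<times> 'mc"
    and D :: "('od, 'md) cat" and PD :: "'md \<Rightarrow> 'md \<Rightarrow> 'md \<times> 'md"
    and K :: "'mc \<Rightarrow> 'mc \<Rightarrow> bool" and \<Gamma> :: "('oc, 'mc, 'od, 'md) functor_data"
begin

text \<open>
  For legs \<open>f : a \<rightarrow> c\<close> and \<open>h : b \<rightarrow> c\<close>, the pullback
  \<open>\<Gamma>(a) \<times> \<Gamma>(b)\<close> over \<open>\<Gamma>(a \<times>\<^sub>c b)\<close> is the object \<open>matching f h\<close>, with projections
  \<open>proj f h\<close> to \<open>\<Gamma>(a)\<close> and \<open>\<Gamma>(b)\<close>.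
\<close>

definition proj :: "'mc \<Rightarrow> 'mc \<Rightarrow> 'md \<times> 'md" where
  "proj f h = PD (on_arr \<Gamma> (fst (PC f h))) (on_arr \<Gamma> (snd (PC f h)))"

definition proj1 :: "'mc \<Rightarrow> 'mc \<Rightarrow> 'md" where
  "proj1 f h = fst (proj f h)"

definition proj2 :: "'mc \<Rightarrow> 'mc \<Rightarrow> 'md" where
  "proj2 f h = snd (proj f h)"

definition matching :: "'mc \<Rightarrow> 'mc \<Rightarrow> 'od" where
  "matching f h = Dom D (proj1 f h)"

definition restriction :: "'mc \<Rightarrow> 'mc \<Rightarrow> 'md" where
  "restriction f h = induced D (proj f h) (on_arr \<Gamma> f) (on_arr \<Gamma> h)"

definition swap :: "'mc \<Rightarrow> 'mc \<Rightarrow> 'md" where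
  "swap f h = induced D (proj h f) (proj2 f h) (proj1 f h)"

end

text \<open>
  The gluing morphism of a bicovering with legs \<open>f\<close> and \<open>h\<close> is \<open>g f h\<close>. As functions are total,
  \<open>extensional\<close> fixes the irrelevant values of \<open>g\<close> on pairs that are not bicoverings, so that
  equality of gluing operations means agreement on all bicoverings.
  In \<open>partial_naturality\<close> the last morphism is \<open>\<Gamma>(qa) \<times> \<Gamma>(qb)\<close>.
\<close>

locale gleaf = gluing_context C PC D PD K \<Gamma>
  for C :: "('oc, 'mc) cat" and PC :: "'mc \<Rightarrow> 'mc \<Rightarrow> 'mc \<times> 'mc"
    and D :: "('od, 'md) cat" and PD :: "'md \<Rightarrow> 'md \<Rightarrow> 'md \<times> 'md"
    and K :: "'mc \<Rightarrow> 'mc \<Rightarrow> bool" and \<Gamma> :: "('oc, 'mc, 'od, 'md) functor_data" +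
  fixes g :: "'mc \<Rightarrow> 'mc \<Rightarrow> 'md"
  assumes glue_hom: "K f h \<Longrightarrow> g f h \<in> hom D (matching f h) (on_obj \<Gamma> (Cod C f))"
    and extensional: "\<not> K f h \<Longrightarrow> g f h = undefined"
    and glue_swap: "K f h \<Longrightarrow> g h f \<cdot>\<^bsub>D\<^esub> swap f h = g f h"
    and identity1: "K (Ident C a) h \<Longrightarrow> a \<in> Obj C \<Longrightarrow> g (Ident C a) h = proj1 (Ident C a) h"
    and identity2: "K f (Ident C b) \<Longrightarrow> b \<in> Obj C \<Longrightarrow> g f (Ident C b) = proj2 f (Ident C b)"
    and back_and_forth: "\<lbrakk>K f h; K k (fst (PC f h))\<rbrakk> \<Longrightarrow>
      g f h \<cdot>\<^bsub>D\<^esub> (restriction f h \<cdot>\<^bsub>D\<^esub> g (f \<cdot>\<^bsub>C\<^esub> k) h) = g (f \<cdot>\<^bsub>C\<^esub> k) h"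
    and partial_naturality: "\<lbrakk>K f' h'; K f h; bicovering_morphism C PC (f', h') (f, h) qa qb qc\<rbrakk> \<Longrightarrow>
      on_arr \<Gamma> qc \<cdot>\<^bsub>D\<^esub> g f h =
      g f' h' \<cdot>\<^bsub>D\<^esub>
        induced D (proj f' h') (on_arr \<Gamma> qa \<cdot>\<^bsub>D\<^esub> proj1 f h) (on_arr \<Gamma> qb \<cdot>\<^bsub>D\<^esub> proj2 f h)"

end

theory Submission
  imports Defs
begin

text \<open>
  Call the pullback square of a bicovering \<open>a \<rightarrow> c \<leftarrow> b\<close> a bicovering square. The proof separates
  into two statements about them.

  First, a sheaf turns bicovering squares into pullback squares of \<open>D\<close>, that is, restriction
  \<open>\<Gamma>(c) \<rightarrow> \<Gamma>(a) \<times> \<Gamma>(b)\<close> is invertible (\<open>sheaf_square_is_pullback\<close>). A pair of generalised elements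
  of \<open>\<Gamma>(a)\<close> and \<open>\<Gamma>(b)\<close> that agree on \<open>a \<times>\<^sub>c b\<close> extends to a cone over the whole generated sieve,
  because each member of the sieve factors through a leg; the factorisation through a given leg is
  unique as the legs are monic, and a member that factors through both legs factors through
  \<open>a \<times>\<^sub>c b\<close>, so that both factorisations give the same value.

  Secondly, a functor that turns bicovering squares into pullback squares is a gleaf in exactly one
  way, for an arbitrary system of bicoverings (\<open>ex1_gleaf_if_squares_are_pullbacks\<close>). Uniqueness
  holds because in any gleaf the glued element restricts to the two elements it was glued from
  (\<open>restrict_glue1\<close>, \<open>restrict_glue2\<close>): the legs \<open>a = a \<leftarrow> a \<times>\<^sub>c b\<close> form a bicovering with a
  morphism to \<open>a \<rightarrow> c \<leftarrow> b\<close> lying over \<open>a \<rightarrow> c\<close>, so partial naturality reduces the restriction to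
  \<open>a\<close> to a gluing that the identity axiom computes. For existence, take the inverse of restriction;
  every axiom is an equation between arrows into some \<open>\<Gamma>(c)\<close>, and these are tested after restriction
  along the two legs.

  That the covering cospans of monomorphisms are a system of bicoverings comes from the axioms
  of a Grothendieck topology (\<open>bicovering_system_covering_cospan\<close>).
\<close>

section \<open>Pullbacks and monomorphisms\<close>

context category
begin

lemma comp_arr:
  "\<lbrakk>f \<in> Arr C; g \<in> Arr C; Cod C f = Dom C g\<rbrakk>
    \<Longrightarrow> g \<cdot> f \<in> Arr C \<and> Dom C (g \<cdot> f) = Dom C f \<and> Cod C (g \<cdot> f) = Cod C g"
  using comp_hom[of f "Dom C f" "Cod C f" g "Cod C g"] by (simp add: hom_def)

lemma pullback_homs:
  assumes "is_pullback C f h p p'"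
  shows "p \<in> hom C (Dom C p) (Dom C f)" "p' \<in> hom C (Dom C p) (Dom C h)"
    "f \<in> hom C (Dom C f) (Cod C f)" "h \<in> hom C (Dom C h) (Cod C f)" "f \<cdot> p = h \<cdot> p'"
  using assms by (auto simp: is_pullback_def cospan_def hom_def)

lemma pullback_lift:
  assumes "is_pullback C f h p p'" "x \<in> hom C z (Dom C f)" "y \<in> hom C z (Dom C h)" "f \<cdot> x = h \<cdot> y"
  obtains w where "w \<in> hom C z (Dom C p)" "p \<cdot> w = x" "p' \<cdot> w = y"
  using assms unfolding is_pullback_def by blast

lemma pullback_jointly_monic:
  assumes pb: "is_pullback C f h p p'"
    and x: "x \<in> hom C z (Dom C p)" and y: "y \<in> hom C z (Dom C p)"
    and "p \<cdot> x = p \<cdot> y" "p' \<cdot> x = p' \<cdot> y"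
  shows "x = y"
proof -
  note h = pullback_homs[OF pb]
  have "f \<cdot> (p \<cdot> x) = h \<cdot> (p' \<cdot> x)"
    using comp_assoc[OF x h(1,3)] comp_assoc[OF x h(2,4)] h(5) by simp
  moreover have "p \<cdot> x \<in> hom C z (Dom C f)" "p' \<cdot> x \<in> hom C z (Dom C h)"
    using comp_hom x h by blast+
  ultimately have "\<exists>!w. w \<in> hom C z (Dom C p) \<and> p \<cdot> w = p \<cdot> x \<and> p' \<cdot> w = p' \<cdot> x"
    using pb unfolding is_pullback_def by blast
  then show ?thesis
    using assms(2-) by auto
qed

lemma induced:
  assumes pb: "is_pullback C f h p p'"
    and x: "x \<in> hom C z (Dom C f)" and y: "y \<in> hom C z (Dom C h)" and "f \<cdot> x = h \<cdot> y"
  shows "induced C (p, p') x y \<in> hom C z (Dom C p)"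
    "p \<cdot> induced C (p, p') x y = x" "p' \<cdot> induced C (p, p') x y = y"
proof -
  have "\<exists>!w. w \<in> hom C z (Dom C p) \<and> p \<cdot> w = x \<and> p' \<cdot> w = y"
    using assms unfolding is_pullback_def by blast
  moreover have "Dom C x = z"
    using x by (simp add: hom_def)
  ultimately have "induced C (p, p') x y \<in> hom C z (Dom C p) \<and>
      p \<cdot> induced C (p, p') x y = x \<and> p' \<cdot> induced C (p, p') x y = y"
    unfolding induced_def by (simp, elim theI')
  then show "induced C (p, p') x y \<in> hom C z (Dom C p)"
    "p \<cdot> induced C (p, p') x y = x" "p' \<cdot> induced C (p, p') x y = y"
    by auto
qed

lemma mono_cancel:
  assumes "is_mono C f" "x \<in> hom C z (Dom C f)" "y \<in> hom C z (Dom C f)" "f \<cdot> x = f \<cdot> y"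
  shows "x = y"
  using assms unfolding is_mono_def by blast

lemma mono_ident:
  assumes "a \<in> Obj C"
  shows "is_mono C (Ident C a)"
  using ident_hom[OF assms] ident_left[of _ _ a] unfolding is_mono_def by (auto simp: hom_def)

lemma mono_comp:
  assumes f: "is_mono C f" and k: "is_mono C k" and "Cod C k = Dom C f"
  shows "is_mono C (f \<cdot> k)"
proof -
  have fh: "f \<in> hom C (Dom C f) (Cod C f)" and kh: "k \<in> hom C (Dom C k) (Dom C f)"
    using assms by (auto simp: is_mono_def hom_def)
  have fk: "f \<cdot> k \<in> hom C (Dom C k) (Cod C f)"
    using comp_hom[OF kh fh] .
  have "x = y" if xy: "x \<in> hom C a (Dom C k)" "y \<in> hom C a (Dom C k)"
    and e: "(f \<cdot> k) \<cdot> x = (f \<cdot> k) \<cdot> y" for a x y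
  proof -
    have "f \<cdot> (k \<cdot> x) = f \<cdot> (k \<cdot> y)"
      using e comp_assoc[OF xy(1) kh fh] comp_assoc[OF xy(2) kh fh] by simp
    then have "k \<cdot> x = k \<cdot> y"
      using mono_cancel[OF f] comp_hom[OF xy(1) kh] comp_hom[OF xy(2) kh] by blast
    then show ?thesis
      using mono_cancel[OF k] xy by blast
  qed
  then show ?thesis
    using fk by (auto simp: is_mono_def hom_def)
qed

lemma mono_pullback:
  assumes pb: "is_pullback C q f f' r" and f: "is_mono C f"
  shows "is_mono C f'"
proof -
  note h = pullback_homs[OF pb]
  have "x = y" if xy: "x \<in> hom C a (Dom C f')" "y \<in> hom C a (Dom C f')"
    and e: "f' \<cdot> x = f' \<cdot> y" for a x y
  proof -
    have "f \<cdot> (r \<cdot> x) = q \<cdot> (f' \<cdot> x)" "f \<cdot> (r \<cdot> y) = q \<cdot> (f' \<cdot> y)"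
      using comp_assoc[OF _ h(1,3)] comp_assoc[OF _ h(2,4)] h(5) xy by metis+
    then have "r \<cdot> x = r \<cdot> y"
      using e mono_cancel[OF f] comp_hom[OF xy(1) h(2)] comp_hom[OF xy(2) h(2)] by metis
    then show ?thesis
      using pullback_jointly_monic[OF pb xy e] by simp
  qed
  then show ?thesis
    using h(1) by (auto simp: is_mono_def hom_def)
qed

lemma mono_kernel_pair:
  assumes f: "is_mono C f"
  shows "is_pullback C f f (Ident C (Dom C f)) (Ident C (Dom C f))"
proof -
  have "f \<in> Arr C"
    using f by (simp add: is_mono_def)
  then have i: "Ident C (Dom C f) \<in> hom C (Dom C f) (Dom C f)"
    using ident_hom dom_obj by blast
  have "\<exists>!w. w \<in> hom C z (Dom C f) \<and> Ident C (Dom C f) \<cdot> w = x \<and> Ident C (Dom C f) \<cdot> w = y"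
    if "x \<in> hom C z (Dom C f)" "y \<in> hom C z (Dom C f)" "f \<cdot> x = f \<cdot> y" for z x y
    using mono_cancel[OF f that] that ident_left by auto
  then show ?thesis
    using i \<open>f \<in> Arr C\<close> by (auto simp: is_pullback_def cospan_def hom_def)
qed


section \<open>Covering cospans form a system of bicoverings\<close>

lemma generated_sieve_iff:
  "s \<in> generated_sieve C {f, h} \<longleftrightarrow>
    (\<exists>u \<in> Arr C. Cod C u = Dom C f \<and> s = f \<cdot> u \<or> Cod C u = Dom C h \<and> s = h \<cdot> u)"
  by (auto simp: generated_sieve_def)

lemma generated_sieve_legs:
  assumes "cospan C f h"
  shows "f \<in> generated_sieve C {f, h}" "h \<in> generated_sieve C {f, h}"
proof -
  have "k \<cdot> Ident C (Dom C k) = k" "Ident C (Dom C k) \<in> Arr C" "Cod C (Ident C (Dom C k)) = Dom C k"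
    if "k \<in> Arr C" for k
    using that ident_right[of k "Dom C k" "Cod C k"] ident_hom[OF dom_obj[OF that]]
    by (auto simp: hom_def)
  then show "f \<in> generated_sieve C {f, h}" "h \<in> generated_sieve C {f, h}"
    using assms unfolding generated_sieve_iff cospan_def by metis+
qed

lemma is_sieve_generated_sieve:
  assumes "cospan C f h"
  shows "is_sieve C (Cod C f) (generated_sieve C {f, h})"
proof -
  have closed: "(k \<cdot> v) \<cdot> u = k \<cdot> (v \<cdot> u)" "v \<cdot> u \<in> Arr C" "Cod C (v \<cdot> u) = Dom C k"
    if "k \<in> Arr C" "v \<in> Arr C" "Cod C v = Dom C k" "u \<in> Arr C" "Cod C u = Dom C v" for k u v
    using that comp_arr[of u v] comp_assoc[of u "Dom C u" "Dom C v" v "Dom C k" k "Cod C k"]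
    by (auto simp: hom_def)
  show ?thesis
    unfolding is_sieve_def
  proof (intro conjI ballI impI subsetI)
    fix s assume "s \<in> generated_sieve C {f, h}"
    then show "s \<in> {s \<in> Arr C. Cod C s = Cod C f}"
      using assms comp_arr unfolding generated_sieve_iff cospan_def by auto
  next
    fix s u assume s: "s \<in> generated_sieve C {f, h}" and u: "u \<in> Arr C" "Cod C u = Dom C s"
    from s obtain k v where k: "k = f \<or> k = h" and v: "v \<in> Arr C" "Cod C v = Dom C k" "s = k \<cdot> v"
      unfolding generated_sieve_iff by blast
    have "k \<in> Arr C"
      using k assms by (auto simp: cospan_def)
    then have "Dom C s = Dom C v"
      using v comp_arr by auto
    then show "s \<cdot> u \<in> generated_sieve C {f, h}"
      using closed[of k v u] \<open>k \<in> Arr C\<close> k v u unfolding generated_sieve_iff by auto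
  qed
qed

lemma is_sieve_pullback_sieve:
  assumes "is_sieve C c S" "q \<in> hom C b c"
  shows "is_sieve C b (pullback_sieve C q S)"
  unfolding is_sieve_def
proof (intro conjI ballI impI subsetI)
  fix u assume "u \<in> pullback_sieve C q S"
  then show "u \<in> {f \<in> Arr C. Cod C f = b}"
    using assms(2) by (auto simp: pullback_sieve_def hom_def)
next
  fix u v assume "u \<in> pullback_sieve C q S" and v: "v \<in> Arr C" "Cod C v = Dom C u"
  then have u: "u \<in> Arr C" "Cod C u = b" "q \<cdot> u \<in> S"
    using assms(2) by (auto simp: pullback_sieve_def hom_def)
  have "Dom C (q \<cdot> u) = Dom C u"
    using u assms(2) comp_arr[of u q] by (auto simp: hom_def)
  then have "(q \<cdot> u) \<cdot> v \<in> S"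
    using assms(1) u v unfolding is_sieve_def by auto
  moreover have "(q \<cdot> u) \<cdot> v = q \<cdot> (u \<cdot> v)"
    using comp_assoc[of v "Dom C v" "Dom C u" u b q c] u v assms(2) by (auto simp: hom_def)
  ultimately show "u \<cdot> v \<in> pullback_sieve C q S"
    using u v comp_arr[of v u] assms(2) by (auto simp: pullback_sieve_def hom_def)
qed

lemma pullback_sieve_of_member:
  assumes "is_sieve C c S" "s \<in> S"
  shows "pullback_sieve C s S = maximal_sieve C (Dom C s)"
  using assms by (auto simp: is_sieve_def pullback_sieve_def maximal_sieve_def)

lemma pullback_sieve_comp:
  assumes "f \<in> hom C a c" "u \<in> hom C b a"
  shows "pullback_sieve C (f \<cdot> u) S = pullback_sieve C u (pullback_sieve C f S)"
proof -
  have "(f \<cdot> u) \<cdot> v = f \<cdot> (u \<cdot> v)" "u \<cdot> v \<in> Arr C" "Cod C (u \<cdot> v) = a"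
    if "v \<in> Arr C" "Cod C v = b" for v
    using that assms comp_assoc[of v "Dom C v" b u a f c] comp_arr[of v u] by (auto simp: hom_def)
  moreover have "Dom C (f \<cdot> u) = b"
    using assms comp_arr[of u f] by (auto simp: hom_def)
  ultimately show ?thesis
    using assms by (auto simp: pullback_sieve_def hom_def)
qed

end

context site
begin

lemma covering_superset:
  assumes c: "c \<in> Obj C" and S: "S \<in> J c" and R: "is_sieve C c R" and "S \<subseteq> R"
  shows "R \<in> J c"
proof (rule transitive[OF c S R])
  fix s assume s: "s \<in> S"
  then have "s \<in> Arr C"
    using sieve[OF c S] by (auto simp: is_sieve_def)
  then show "pullback_sieve C s R \<in> J (Dom C s)"
    using pullback_sieve_of_member[OF R] s \<open>S \<subseteq> R\<close> maximal dom_obj by auto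
qed

lemma covering_cospan_ident:
  assumes a: "a \<in> Obj C"
  shows "covering_cospan C J (Ident C a) (Ident C a)"
proof -
  have i: "Ident C a \<in> Arr C" "Dom C (Ident C a) = a" "Cod C (Ident C a) = a"
    using ident_hom[OF a] by (auto simp: hom_def)
  then have cs: "cospan C (Ident C a) (Ident C a)"
    by (simp add: cospan_def)
  have "maximal_sieve C a \<subseteq> generated_sieve C {Ident C a, Ident C a}"
  proof
    fix s assume "s \<in> maximal_sieve C a"
    then have s: "s \<in> Arr C" "Cod C s = a"
      by (simp_all add: maximal_sieve_def)
    then have "s = Ident C a \<cdot>\<^bsub>C\<^esub> s"
      using ident_left[of s "Dom C s" a] by (simp add: hom_def)
    then show "s \<in> generated_sieve C {Ident C a, Ident C a}"
      using s i(2) unfolding generated_sieve_iff by metis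
  qed
  then have "generated_sieve C {Ident C a, Ident C a} \<in> J a"
    using covering_superset[OF a maximal[OF a]] is_sieve_generated_sieve[OF cs] i by simp
  then show ?thesis
    using cs i mono_ident[OF a] by (simp add: covering_cospan_def)
qed

text \<open>
  By transitivity it suffices to look at the pullbacks of the composite sieve along the legs
  \<open>f\<close> and \<open>h\<close>. Along \<open>h\<close> it is maximal; along \<open>f\<close> it contains the sieve generated by \<open>k\<close> and \<open>p\<close>,
  as \<open>f \<cdot> p\<close> factors through \<open>h\<close>.
\<close>

lemma covering_cospan_comp:
  assumes fh: "covering_cospan C J f h" and pb: "is_pullback C f h p p'"
    and kp: "covering_cospan C J k p"
  shows "covering_cospan C J (f \<cdot>\<^bsub>C\<^esub> k) h"
proof -
  let ?R = "generated_sieve C {f \<cdot>\<^bsub>C\<^esub> k, h}"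
  define c where "c = Cod C f"
  note P = pullback_homs[OF pb]
  have f: "f \<in> hom C (Dom C f) c" and h: "h \<in> hom C (Dom C h) c" and c: "c \<in> Obj C"
    using P cod_obj by (auto simp: c_def hom_def)
  have k: "k \<in> hom C (Dom C k) (Dom C f)"
    using kp P(1) by (auto simp: covering_cospan_def cospan_def hom_def)
  have fk: "f \<cdot>\<^bsub>C\<^esub> k \<in> hom C (Dom C k) c"
    using comp_hom[OF k f] .
  have cs: "cospan C (f \<cdot>\<^bsub>C\<^esub> k) h"
    using fk h by (auto simp: cospan_def hom_def)
  have R: "is_sieve C c ?R"
    using is_sieve_generated_sieve[OF cs] fk by (simp add: hom_def)
  have a: "Dom C f \<in> Obj C"
    using f dom_obj by (auto simp: hom_def)
  have "generated_sieve C {k, p} \<subseteq> pullback_sieve C f ?R"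
  proof
    fix s assume "s \<in> generated_sieve C {k, p}"
    then obtain u where u: "u \<in> Arr C"
      "Cod C u = Dom C k \<and> s = k \<cdot>\<^bsub>C\<^esub> u \<or> Cod C u = Dom C p \<and> s = p \<cdot>\<^bsub>C\<^esub> u"
      unfolding generated_sieve_iff by blast
    from u(2) show "s \<in> pullback_sieve C f ?R"
    proof (elim disjE conjE)
      assume "Cod C u = Dom C k" "s = k \<cdot>\<^bsub>C\<^esub> u"
      moreover then have "f \<cdot>\<^bsub>C\<^esub> s = (f \<cdot>\<^bsub>C\<^esub> k) \<cdot>\<^bsub>C\<^esub> u"
        using comp_assoc[of u "Dom C u" "Dom C k", OF _ k f] u(1) by (simp add: hom_def)
      ultimately show ?thesis
        using u(1) k fk comp_arr[of u k] unfolding pullback_sieve_def generated_sieve_iff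
        by (auto simp: hom_def)
    next
      assume e: "Cod C u = Dom C p" "s = p \<cdot>\<^bsub>C\<^esub> u"
      then have u': "u \<in> hom C (Dom C u) (Dom C p)"
        using u(1) by (simp add: hom_def)
      have "f \<cdot>\<^bsub>C\<^esub> s = h \<cdot>\<^bsub>C\<^esub> (p' \<cdot>\<^bsub>C\<^esub> u)"
        using comp_assoc[OF u' P(1) f] comp_assoc[OF u' P(2) h] P(5) e by simp
      then show ?thesis
        using comp_hom[OF u' P(1)] comp_hom[OF u' P(2)] e
        unfolding pullback_sieve_def generated_sieve_iff by (auto simp: hom_def)
    qed
  qed
  moreover have "generated_sieve C {k, p} \<in> J (Dom C f)"
    using kp k by (auto simp: covering_cospan_def hom_def)
  ultimately have J: "pullback_sieve C f ?R \<in> J (Dom C f)"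
    using covering_superset[OF a] is_sieve_pullback_sieve[OF R f] by blast
  have "?R \<in> J c"
  proof (rule transitive[OF c _ R])
    show "generated_sieve C {f, h} \<in> J c"
      using fh by (simp add: covering_cospan_def c_def)
    fix s assume "s \<in> generated_sieve C {f, h}"
    then obtain u where u: "u \<in> Arr C"
      "Cod C u = Dom C f \<and> s = f \<cdot>\<^bsub>C\<^esub> u \<or> Cod C u = Dom C h \<and> s = h \<cdot>\<^bsub>C\<^esub> u"
      unfolding generated_sieve_iff by blast
    from u(2) show "pullback_sieve C s ?R \<in> J (Dom C s)"
    proof (elim disjE conjE)
      assume e: "Cod C u = Dom C f" "s = f \<cdot>\<^bsub>C\<^esub> u"
      then have u': "u \<in> hom C (Dom C s) (Dom C f)"
        using u(1) f comp_arr[of u f] by (auto simp: hom_def)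
      show ?thesis
        using stable[OF a J u'] pullback_sieve_comp[OF f u'] e by simp
    next
      assume e: "Cod C u = Dom C h" "s = h \<cdot>\<^bsub>C\<^esub> u"
      then have "s \<in> ?R" "s \<in> Arr C"
        using u(1) h comp_arr[of u h] unfolding generated_sieve_iff by (auto simp: hom_def)
      then show ?thesis
        using pullback_sieve_of_member[OF R] maximal dom_obj by simp
    qed
  qed
  moreover have "is_mono C (f \<cdot>\<^bsub>C\<^esub> k)"
    using mono_comp fh kp k by (auto simp: covering_cospan_def hom_def)
  ultimately show ?thesis
    using cs fk fh by (auto simp: covering_cospan_def hom_def)
qed

text \<open>
  If \<open>q \<cdot> u\<close> factors through a leg, then \<open>u\<close> factors through the pullback of that leg. So the sieve
  generated by the pulled back legs contains the pullback of a covering sieve.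
\<close>

lemma covering_cospan_stable:
  assumes fh: "covering_cospan C J f h"
    and pf: "is_pullback C q f f' r" and ph: "is_pullback C q h h' s"
  shows "covering_cospan C J f' h'"
proof -
  note F = pullback_homs[OF pf] and H = pullback_homs[OF ph]
  have c: "Cod C q \<in> Obj C" and b: "Dom C q \<in> Obj C"
    using F cod_obj dom_obj by (auto simp: hom_def)
  have cs: "cospan C f' h'" and f': "Cod C f' = Dom C q"
    using F H by (auto simp: cospan_def hom_def)
  have sv: "is_sieve C (Dom C q) (generated_sieve C {f', h'})"
    using is_sieve_generated_sieve[OF cs] f' by simp
  have "generated_sieve C {f, h} \<in> J (Cod C q)"
    using fh F(4) by (simp add: covering_cospan_def hom_def)
  then have "pullback_sieve C q (generated_sieve C {f, h}) \<in> J (Dom C q)"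
    using stable[OF c _ F(3)] by blast
  moreover have "pullback_sieve C q (generated_sieve C {f, h}) \<subseteq> generated_sieve C {f', h'}"
  proof
    fix u assume "u \<in> pullback_sieve C q (generated_sieve C {f, h})"
    then obtain v where u: "u \<in> hom C (Dom C u) (Dom C q)" and v: "v \<in> Arr C"
      and d: "Cod C v = Dom C f \<and> q \<cdot>\<^bsub>C\<^esub> u = f \<cdot>\<^bsub>C\<^esub> v \<or> Cod C v = Dom C h \<and> q \<cdot>\<^bsub>C\<^esub> u = h \<cdot>\<^bsub>C\<^esub> v"
      unfolding pullback_sieve_def generated_sieve_iff by (auto simp: hom_def)
    have dom: "Dom C v = Dom C u"
      using d u v F(3,4) H(4) comp_arr[of u q] comp_arr[of v f] comp_arr[of v h]
      by (auto simp: hom_def)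
    from d show "u \<in> generated_sieve C {f', h'}"
    proof (elim disjE conjE)
      assume "Cod C v = Dom C f" "q \<cdot>\<^bsub>C\<^esub> u = f \<cdot>\<^bsub>C\<^esub> v"
      then show ?thesis
        using pullback_lift[OF pf u, of v] v dom unfolding generated_sieve_iff hom_def by auto
    next
      assume "Cod C v = Dom C h" "q \<cdot>\<^bsub>C\<^esub> u = h \<cdot>\<^bsub>C\<^esub> v"
      then show ?thesis
        using pullback_lift[OF ph u, of v] v dom unfolding generated_sieve_iff hom_def by auto
    qed
  qed
  ultimately have "generated_sieve C {f', h'} \<in> J (Dom C q)"
    using covering_superset[OF b _ sv] by blast
  then show ?thesis
    using cs f' mono_pullback[OF pf] mono_pullback[OF ph] fh by (simp add: covering_cospan_def)
qed

lemma bicovering_system_covering_cospan: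
  assumes "category_with_pullbacks C PC"
  shows "bicovering_system C (covering_cospan C J)"
proof
  interpret CP: category_with_pullbacks C PC by fact
  show "\<exists>p p'. is_pullback C f q p p'" if "cospan C f q" for f q
    using CP.pullback[OF that] by blast
  show "covering_cospan C J h f" if "covering_cospan C J f h" for f h
    using that by (auto simp: covering_cospan_def cospan_def insert_commute)
  show "cospan C f h" "is_mono C f \<and> is_mono C h" if "covering_cospan C J f h" for f h
    using that by (simp_all add: covering_cospan_def)
qed (blast intro: covering_cospan_ident covering_cospan_comp covering_cospan_stable)+

end


section \<open>Gluing along squares that become pullbacks\<close>

context gluing_context
begin

lemma hom_op_cat [simp]: "hom (op_cat C) a b = hom C b a"
  by (auto simp: hom_def op_cat_def)

lemma restrict_hom: "u \<in> hom C a b \<Longrightarrow> on_arr \<Gamma> u \<in> hom D (on_obj \<Gamma> b) (on_obj \<Gamma> a)"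
  using on_arr by simp

lemma restrict_comp:
  "\<lbrakk>u \<in> hom C a b; v \<in> hom C b c\<rbrakk> \<Longrightarrow> on_arr \<Gamma> (v \<cdot>\<^bsub>C\<^esub> u) = on_arr \<Gamma> u \<cdot>\<^bsub>D\<^esub> on_arr \<Gamma> v"
  using on_comp[of v c b u a, unfolded hom_op_cat] by (simp add: op_cat_def)

lemma restrict_restrict:
  assumes "u \<in> hom C a b" "v \<in> hom C b c" "x \<in> hom D z (on_obj \<Gamma> c)"
  shows "on_arr \<Gamma> u \<cdot>\<^bsub>D\<^esub> (on_arr \<Gamma> v \<cdot>\<^bsub>D\<^esub> x) = on_arr \<Gamma> (v \<cdot>\<^bsub>C\<^esub> u) \<cdot>\<^bsub>D\<^esub> x"
  using DP.comp_assoc[OF assms(3) restrict_hom[OF assms(2)] restrict_hom[OF assms(1)]]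
    restrict_comp[OF assms(1,2)] by simp

lemma restrict_ident:
  assumes "a \<in> Obj C" "x \<in> hom D z (on_obj \<Gamma> a)"
  shows "on_arr \<Gamma> (Ident C a) \<cdot>\<^bsub>D\<^esub> x = x"
  using on_ident[of a] DP.ident_left[OF assms(2)] assms(1) by (simp add: op_cat_def)

text \<open>
  Agreement on the chosen pullback \<open>a \<times>\<^sub>c b\<close> is agreement on every commuting square over the cospan.
\<close>

lemma agree_on_square:
  assumes cs: "cospan C f h" and u: "u \<in> hom C d (Dom C f)" and v: "v \<in> hom C d (Dom C h)"
    and e: "f \<cdot>\<^bsub>C\<^esub> u = h \<cdot>\<^bsub>C\<^esub> v"
    and x: "x \<in> hom D z (on_obj \<Gamma> (Dom C f))" and y: "y \<in> hom D z (on_obj \<Gamma> (Dom C h))"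
    and agree: "on_arr \<Gamma> (fst (PC f h)) \<cdot>\<^bsub>D\<^esub> x = on_arr \<Gamma> (snd (PC f h)) \<cdot>\<^bsub>D\<^esub> y"
  shows "on_arr \<Gamma> u \<cdot>\<^bsub>D\<^esub> x = on_arr \<Gamma> v \<cdot>\<^bsub>D\<^esub> y"
proof -
  note pb = CP.pullback[OF cs]
  note P = CP.pullback_homs[OF pb]
  obtain w where w: "w \<in> hom C d (Dom C (fst (PC f h)))"
    "fst (PC f h) \<cdot>\<^bsub>C\<^esub> w = u" "snd (PC f h) \<cdot>\<^bsub>C\<^esub> w = v"
    using CP.pullback_lift[OF pb u v e] .
  show ?thesis
    using restrict_restrict[OF w(1) P(1) x] restrict_restrict[OF w(1) P(2) y] w agree by simp
qed

lemma proj_pullback: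
  assumes cs: "cospan C f h"
  shows "is_pullback D (on_arr \<Gamma> (fst (PC f h))) (on_arr \<Gamma> (snd (PC f h))) (proj1 f h) (proj2 f h)"
proof -
  note P = CP.pullback_homs[OF CP.pullback[OF cs]]
  have "cospan D (on_arr \<Gamma> (fst (PC f h))) (on_arr \<Gamma> (snd (PC f h)))"
    using restrict_hom[OF P(1)] restrict_hom[OF P(2)] by (auto simp: cospan_def hom_def)
  then show ?thesis
    unfolding proj1_def proj2_def proj_def by (rule DP.pullback)
qed

lemma restrict_dom:
  assumes "u \<in> hom C a b"
  shows "Dom D (on_arr \<Gamma> u) = on_obj \<Gamma> b" "Cod D (on_arr \<Gamma> u) = on_obj \<Gamma> a"
  using restrict_hom[OF assms] by (auto simp: hom_def)

lemma proj_hom: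
  assumes cs: "cospan C f h"
  shows "proj1 f h \<in> hom D (matching f h) (on_obj \<Gamma> (Dom C f))"
    "proj2 f h \<in> hom D (matching f h) (on_obj \<Gamma> (Dom C h))"
    "on_arr \<Gamma> (fst (PC f h)) \<cdot>\<^bsub>D\<^esub> proj1 f h = on_arr \<Gamma> (snd (PC f h)) \<cdot>\<^bsub>D\<^esub> proj2 f h"
proof -
  note P = CP.pullback_homs[OF CP.pullback[OF cs]]
  show "proj1 f h \<in> hom D (matching f h) (on_obj \<Gamma> (Dom C f))"
    "proj2 f h \<in> hom D (matching f h) (on_obj \<Gamma> (Dom C h))"
    "on_arr \<Gamma> (fst (PC f h)) \<cdot>\<^bsub>D\<^esub> proj1 f h = on_arr \<Gamma> (snd (PC f h)) \<cdot>\<^bsub>D\<^esub> proj2 f h"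
    using DP.pullback_homs[OF proj_pullback[OF cs]] restrict_dom[OF P(1)] restrict_dom[OF P(2)]
    by (simp_all add: matching_def)
qed

lemma proj_agree:
  assumes "cospan C f h" "u \<in> hom C d (Dom C f)" "v \<in> hom C d (Dom C h)" "f \<cdot>\<^bsub>C\<^esub> u = h \<cdot>\<^bsub>C\<^esub> v"
  shows "on_arr \<Gamma> u \<cdot>\<^bsub>D\<^esub> proj1 f h = on_arr \<Gamma> v \<cdot>\<^bsub>D\<^esub> proj2 f h"
  using agree_on_square[OF assms] proj_hom[OF assms(1)] by blast

lemma induced_proj:
  assumes cs: "cospan C f h"
    and x: "x \<in> hom D z (on_obj \<Gamma> (Dom C f))" and y: "y \<in> hom D z (on_obj \<Gamma> (Dom C h))"
    and e: "on_arr \<Gamma> (fst (PC f h)) \<cdot>\<^bsub>D\<^esub> x = on_arr \<Gamma> (snd (PC f h)) \<cdot>\<^bsub>D\<^esub> y"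
  shows "induced D (proj f h) x y \<in> hom D z (matching f h)"
    "proj1 f h \<cdot>\<^bsub>D\<^esub> induced D (proj f h) x y = x"
    "proj2 f h \<cdot>\<^bsub>D\<^esub> induced D (proj f h) x y = y"
proof -
  note P = CP.pullback_homs[OF CP.pullback[OF cs]]
  have "proj f h = (proj1 f h, proj2 f h)"
    by (simp add: proj1_def proj2_def)
  moreover have "x \<in> hom D z (Dom D (on_arr \<Gamma> (fst (PC f h))))"
    "y \<in> hom D z (Dom D (on_arr \<Gamma> (snd (PC f h))))"
    using x y restrict_dom[OF P(1)] restrict_dom[OF P(2)] by simp_all
  ultimately show "induced D (proj f h) x y \<in> hom D z (matching f h)"
    "proj1 f h \<cdot>\<^bsub>D\<^esub> induced D (proj f h) x y = x"
    "proj2 f h \<cdot>\<^bsub>D\<^esub> induced D (proj f h) x y = y"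
    using DP.induced[OF proj_pullback[OF cs] _ _ e, of z] by (simp_all add: matching_def)
qed

lemma cospan_sym: "cospan C f h \<Longrightarrow> cospan C h f"
  by (simp add: cospan_def)

lemma swap:
  assumes cs: "cospan C f h"
  shows "swap f h \<in> hom D (matching f h) (matching h f)"
    "proj1 h f \<cdot>\<^bsub>D\<^esub> swap f h = proj2 f h" "proj2 h f \<cdot>\<^bsub>D\<^esub> swap f h = proj1 f h"
proof -
  note P = CP.pullback_homs[OF CP.pullback[OF cospan_sym[OF cs]]]
  note q = proj_hom[OF cs]
  have "on_arr \<Gamma> (fst (PC h f)) \<cdot>\<^bsub>D\<^esub> proj2 f h = on_arr \<Gamma> (snd (PC h f)) \<cdot>\<^bsub>D\<^esub> proj1 f h"
    using proj_agree[OF cs P(2) P(1)] P(5) by simp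
  then show "swap f h \<in> hom D (matching f h) (matching h f)"
    "proj1 h f \<cdot>\<^bsub>D\<^esub> swap f h = proj2 f h" "proj2 h f \<cdot>\<^bsub>D\<^esub> swap f h = proj1 f h"
    using induced_proj[OF cospan_sym[OF cs] q(2,1)] by (simp_all add: swap_def)
qed

lemma restriction:
  assumes cs: "cospan C f h"
  shows "restriction f h \<in> hom D (on_obj \<Gamma> (Cod C f)) (matching f h)"
    "proj1 f h \<cdot>\<^bsub>D\<^esub> restriction f h = on_arr \<Gamma> f"
    "proj2 f h \<cdot>\<^bsub>D\<^esub> restriction f h = on_arr \<Gamma> h"
proof -
  note P = CP.pullback_homs[OF CP.pullback[OF cs]]
  have "on_arr \<Gamma> (fst (PC f h)) \<cdot>\<^bsub>D\<^esub> on_arr \<Gamma> f = on_arr \<Gamma> (snd (PC f h)) \<cdot>\<^bsub>D\<^esub> on_arr \<Gamma> h"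
    using restrict_comp[OF P(1,3)] restrict_comp[OF P(2,4)] P(5) by simp
  then show "restriction f h \<in> hom D (on_obj \<Gamma> (Cod C f)) (matching f h)"
    "proj1 f h \<cdot>\<^bsub>D\<^esub> restriction f h = on_arr \<Gamma> f"
    "proj2 f h \<cdot>\<^bsub>D\<^esub> restriction f h = on_arr \<Gamma> h"
    using induced_proj[OF cs restrict_hom[OF P(3)] restrict_hom[OF P(4)]]
    by (simp_all add: restriction_def)
qed

text \<open>
  The projection \<open>a \<times>\<^sub>a (a \<times>\<^sub>c b) \<rightarrow> a \<times>\<^sub>c b\<close> is invertible, being a pullback of an identity, and the
  map induced between the apexes is this projection; hence the right inverse \<open>s\<close>.
\<close>

lemma bicovering_morphism_from_leg:
  assumes cs: "cospan C f h"
  shows "bicovering_morphism C PC (Ident C (Dom C f), fst (PC f h)) (f, h)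
    (Ident C (Dom C f)) (snd (PC f h)) f"
proof -
  obtain p p' where pp: "PC f h = (p, p')"
    by fastforce
  note pb = CP.pullback[OF cs, unfolded pp fst_conv snd_conv]
  note P = CP.pullback_homs[OF pb]
  define i where "i = Ident C (Dom C f)"
  define d where "d = Dom C p"
  have i: "i \<in> hom C (Dom C f) (Dom C f)"
    using P(3) CP.dom_obj CP.ident_hom by (auto simp: i_def hom_def)
  have i': "Dom C i = Dom C f" "Cod C i = Dom C f"
    using i by (auto simp: hom_def)
  have ip: "cospan C i p"
    using i P(1) by (simp add: cospan_def hom_def)
  obtain r r' where rr: "PC i p = (r, r')"
    by fastforce
  note pb' = CP.pullback[OF ip, unfolded rr fst_conv snd_conv]
  note R = CP.pullback_homs[OF pb', unfolded i']
  have id: "Ident C d \<in> hom C d d"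
    using P(1) CP.dom_obj CP.ident_hom by (auto simp: d_def hom_def)
  have p: "p \<in> hom C d (Dom C f)" and p': "p' \<in> hom C d (Dom C h)"
    and r: "r \<in> hom C (Dom C r) (Dom C f)" and r': "r' \<in> hom C (Dom C r) d"
    using P R by (simp_all add: d_def)
  have ir: "i \<cdot>\<^bsub>C\<^esub> r = r"
    using CP.ident_left[OF r] by (simp add: i_def)
  have rp: "r = p \<cdot>\<^bsub>C\<^esub> r'"
    using R(5) ir by simp
  have "i \<cdot>\<^bsub>C\<^esub> p = p \<cdot>\<^bsub>C\<^esub> Ident C d"
    using CP.ident_left[OF p] CP.ident_right[OF p] by (simp add: i_def)
  then obtain s where s: "s \<in> hom C d (Dom C r)" "r \<cdot>\<^bsub>C\<^esub> s = p" "r' \<cdot>\<^bsub>C\<^esub> s = Ident C d"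
    using CP.pullback_lift[OF pb', of p d "Ident C d"] p id i' by (auto simp: d_def)
  define t where "t = induced C (p, p') (i \<cdot>\<^bsub>C\<^esub> r) (p' \<cdot>\<^bsub>C\<^esub> r')"
  have pr': "p' \<cdot>\<^bsub>C\<^esub> r' \<in> hom C (Dom C r) (Dom C h)"
    using CP.comp_hom[OF r' p'] .
  have "f \<cdot>\<^bsub>C\<^esub> r = h \<cdot>\<^bsub>C\<^esub> (p' \<cdot>\<^bsub>C\<^esub> r')"
    using CP.comp_assoc[OF r' p P(3)] CP.comp_assoc[OF r' p' P(4)] P(5) rp by simp
  then have t: "t \<in> hom C (Dom C r) d" "p \<cdot>\<^bsub>C\<^esub> t = r" "p' \<cdot>\<^bsub>C\<^esub> t = p' \<cdot>\<^bsub>C\<^esub> r'"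
    using CP.induced[OF pb r pr'] by (simp_all add: t_def ir d_def)
  have "p \<cdot>\<^bsub>C\<^esub> (t \<cdot>\<^bsub>C\<^esub> s) = p \<cdot>\<^bsub>C\<^esub> Ident C d"
    using CP.comp_assoc[OF s(1) t(1) p] CP.ident_right[OF p] t(2) s(2) by simp
  moreover have "p' \<cdot>\<^bsub>C\<^esub> (t \<cdot>\<^bsub>C\<^esub> s) = p' \<cdot>\<^bsub>C\<^esub> Ident C d"
    using CP.comp_assoc[OF s(1) t(1) p'] CP.comp_assoc[OF s(1) r' p'] t(3) s(3) by simp
  ultimately have "t \<cdot>\<^bsub>C\<^esub> s = Ident C d"
    using CP.pullback_jointly_monic[OF pb, of "t \<cdot>\<^bsub>C\<^esub> s" d "Ident C d"]
      CP.comp_hom[OF s(1) t(1)] id by (simp add: d_def)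
  then have "\<exists>s \<in> hom C d (Dom C r). t \<cdot>\<^bsub>C\<^esub> s = Ident C d"
    using s(1) by blast
  then show ?thesis
    using i i' p' P(3,5) rr
    by (simp add: bicovering_morphism_def pp i_def[symmetric] t_def d_def)
qed

end

context gleaf
begin

text \<open>
  Partial naturality along the morphism from the bicovering \<open>a = a \<leftarrow> a \<times>\<^sub>c b\<close> turns the left-hand
  side into a gluing over that bicovering, which is the first projection by the identity axiom.
\<close>

lemma restrict_glue1:
  assumes K: "K f h"
  shows "on_arr \<Gamma> f \<cdot>\<^bsub>D\<^esub> g f h = proj1 f h"
proof -
  define i p p' where "i = Ident C (Dom C f)" and "p = fst (PC f h)" and "p' = snd (PC f h)"
  have cs: "cospan C f h"
    using bicovering_cospan[OF K] .
  note pb = CP.pullback[OF cs, folded p_def p'_def]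
  note P = CP.pullback_homs[OF pb]
  note q = proj_hom[OF cs, folded p_def p'_def]
  have a: "Dom C f \<in> Obj C"
    using P(3) CP.dom_obj by (auto simp: hom_def)
  \<comment> \<open>This is the given bicovering pulled back along its own leg \<open>f\<close>, which is monic.\<close>
  have Kip: "K i p"
    using bicovering_stable[OF K CP.mono_kernel_pair pb] bicovering_mono[OF K]
    by (simp add: i_def)
  note cs' = bicovering_cospan[OF Kip]
  note R = CP.pullback_homs[OF CP.pullback[OF cs']]
  have i: "i \<in> hom C (Dom C f) (Dom C f)"
    using CP.ident_hom[OF a] by (simp add: i_def)
  then have i': "Dom C i = Dom C f"
    by (simp add: hom_def)
  have x: "on_arr \<Gamma> i \<cdot>\<^bsub>D\<^esub> proj1 f h = proj1 f h"
    using restrict_ident[OF a q(1)] by (simp add: i_def)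
  have y: "on_arr \<Gamma> p' \<cdot>\<^bsub>D\<^esub> proj2 f h \<in> hom D (matching f h) (on_obj \<Gamma> (Dom C p))"
    using DP.comp_hom[OF q(2) restrict_hom[OF P(2)]] .
  have "fst (PC i p) \<in> hom C (Dom C (fst (PC i p))) (Dom C f)"
    using R(1) i' by simp
  then have rp: "fst (PC i p) = p \<cdot>\<^bsub>C\<^esub> snd (PC i p)"
    using CP.ident_left R(5) by (simp add: i_def)
  have "on_arr \<Gamma> (fst (PC i p)) \<cdot>\<^bsub>D\<^esub> proj1 f h
      = on_arr \<Gamma> (snd (PC i p)) \<cdot>\<^bsub>D\<^esub> (on_arr \<Gamma> p' \<cdot>\<^bsub>D\<^esub> proj2 f h)"
    using restrict_restrict[OF R(2) P(1) q(1)] q(3) rp by simp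
  then have "proj1 i p \<cdot>\<^bsub>D\<^esub> induced D (proj i p) (proj1 f h) (on_arr \<Gamma> p' \<cdot>\<^bsub>D\<^esub> proj2 f h) = proj1 f h"
    using induced_proj(2)[OF cs' _ y] q(1) i' by simp
  moreover have "on_arr \<Gamma> f \<cdot>\<^bsub>D\<^esub> g f h
      = g i p \<cdot>\<^bsub>D\<^esub> induced D (proj i p) (proj1 f h) (on_arr \<Gamma> p' \<cdot>\<^bsub>D\<^esub> proj2 f h)"
    using partial_naturality[OF Kip K, of i p' f] bicovering_morphism_from_leg[OF cs] x
    by (simp add: i_def p_def p'_def)
  moreover have "g i p = proj1 i p"
    using identity1[of "Dom C f" p] Kip a by (simp add: i_def)
  ultimately show ?thesis
    by simp
qed

text \<open>
  Exchanging the legs reduces this to the first leg, by the symmetry axiom on gluing.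
\<close>

lemma restrict_glue2:
  assumes K: "K f h"
  shows "on_arr \<Gamma> h \<cdot>\<^bsub>D\<^esub> g f h = proj2 f h"
proof -
  note cs = bicovering_cospan[OF K] and K' = bicovering_sym[OF K]
  have "h \<in> hom C (Dom C h) (Cod C h)"
    using cs by (simp add: cospan_def hom_def)
  then have "(on_arr \<Gamma> h \<cdot>\<^bsub>D\<^esub> g h f) \<cdot>\<^bsub>D\<^esub> swap f h = on_arr \<Gamma> h \<cdot>\<^bsub>D\<^esub> g f h"
    using DP.comp_assoc[OF swap(1)[OF cs] glue_hom[OF K'] restrict_hom] glue_swap[OF K] by simp
  then show ?thesis
    using restrict_glue1[OF K'] swap(2)[OF cs] by simp
qed

end

context gluing_context
begin

text \<open>
  An arrow into \<open>\<Gamma>(c)\<close> is determined by its two restrictions (\<open>ext\<close> below), and those of a glued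
  element are known, so each axiom becomes a comparison of restrictions.
\<close>

theorem ex1_gleaf_if_squares_are_pullbacks:
  assumes squares: "\<And>f h. K f h \<Longrightarrow>
    is_pullback D (on_arr \<Gamma> (fst (PC f h))) (on_arr \<Gamma> (snd (PC f h))) (on_arr \<Gamma> f) (on_arr \<Gamma> h)"
  shows "\<exists>!g. gleaf C PC D PD K \<Gamma> g"
proof -
  have arrs: "f \<in> hom C (Dom C f) (Cod C f)" "h \<in> hom C (Dom C h) (Cod C f)" if "K f h" for f h
    using bicovering_cospan[OF that] by (auto simp: cospan_def hom_def)
  have ext: "x = y"
    if "K f h" "x \<in> hom D z (on_obj \<Gamma> (Cod C f))" "y \<in> hom D z (on_obj \<Gamma> (Cod C f))"
      "on_arr \<Gamma> f \<cdot>\<^bsub>D\<^esub> x = on_arr \<Gamma> f \<cdot>\<^bsub>D\<^esub> y" "on_arr \<Gamma> h \<cdot>\<^bsub>D\<^esub> x = on_arr \<Gamma> h \<cdot>\<^bsub>D\<^esub> y" for f h x y z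
    using DP.pullback_jointly_monic[OF squares[OF that(1)], of x z y] that
      restrict_dom[OF arrs(1)[OF that(1)]] by simp
  define g where "g f h = (if K f h
    then induced D (on_arr \<Gamma> f, on_arr \<Gamma> h) (proj1 f h) (proj2 f h) else undefined)" for f h
  have g: "g f h \<in> hom D (matching f h) (on_obj \<Gamma> (Cod C f))"
    "on_arr \<Gamma> f \<cdot>\<^bsub>D\<^esub> g f h = proj1 f h" "on_arr \<Gamma> h \<cdot>\<^bsub>D\<^esub> g f h = proj2 f h" if K: "K f h" for f h
  proof -
    note cs = bicovering_cospan[OF K]
    note P = CP.pullback_homs[OF CP.pullback[OF cs]]
    note q = proj_hom[OF cs]
    have "proj1 f h \<in> hom D (matching f h) (Dom D (on_arr \<Gamma> (fst (PC f h))))"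
      "proj2 f h \<in> hom D (matching f h) (Dom D (on_arr \<Gamma> (snd (PC f h))))"
      using q restrict_dom[OF P(1)] restrict_dom[OF P(2)] by simp_all
    from DP.induced[OF squares[OF K] this q(3)] K restrict_dom[OF P(3)]
    show "g f h \<in> hom D (matching f h) (on_obj \<Gamma> (Cod C f))"
      "on_arr \<Gamma> f \<cdot>\<^bsub>D\<^esub> g f h = proj1 f h" "on_arr \<Gamma> h \<cdot>\<^bsub>D\<^esub> g f h = proj2 f h"
      by (simp_all add: g_def)
  qed
  have g': "on_arr \<Gamma> f \<cdot>\<^bsub>D\<^esub> (g f h \<cdot>\<^bsub>D\<^esub> m) = proj1 f h \<cdot>\<^bsub>D\<^esub> m"
    "on_arr \<Gamma> h \<cdot>\<^bsub>D\<^esub> (g f h \<cdot>\<^bsub>D\<^esub> m) = proj2 f h \<cdot>\<^bsub>D\<^esub> m"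
    if K: "K f h" and m: "m \<in> hom D z (matching f h)" for f h m z
    using DP.comp_assoc[OF m g(1)[OF K] restrict_hom[OF arrs(1)[OF K]]]
      DP.comp_assoc[OF m g(1)[OF K] restrict_hom[OF arrs(2)[OF K]]] g(2,3)[OF K] by simp_all
  have "gleaf C PC D PD K \<Gamma> g"
  proof (intro gleaf.intro gleaf_axioms.intro)
    show "gluing_context C PC D PD K \<Gamma>"
      by unfold_locales
  next
    fix f h assume K: "K f h"
    show "g f h \<in> hom D (matching f h) (on_obj \<Gamma> (Cod C f))"
      using g(1)[OF K] .
    note cs = bicovering_cospan[OF K] and K' = bicovering_sym[OF K]
    note sw = swap[OF cs]
    have "g h f \<cdot>\<^bsub>D\<^esub> swap f h \<in> hom D (matching f h) (on_obj \<Gamma> (Cod C f))"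
      using DP.comp_hom[OF sw(1) g(1)[OF K']] cs by (simp add: cospan_def)
    then show "g h f \<cdot>\<^bsub>D\<^esub> swap f h = g f h"
      using ext[OF K _ g(1)[OF K]] g'[OF K' sw(1)] g(2,3)[OF K] sw(2,3) by simp
  next
    fix f h assume "\<not> K f h"
    then show "g f h = undefined"
      by (simp add: g_def)
  next
    fix a h assume K: "K (Ident C a) h" and a: "a \<in> Obj C"
    then show "g (Ident C a) h = proj1 (Ident C a) h"
      using g(1,2)[OF K] restrict_ident[OF a] CP.ident_hom[OF a] by (auto simp: hom_def)
  next
    fix f b assume K: "K f (Ident C b)" and b: "b \<in> Obj C"
    then have "Cod C f = b"
      using bicovering_cospan[OF K] CP.ident_hom[OF b] by (auto simp: cospan_def hom_def)
    then show "g f (Ident C b) = proj2 f (Ident C b)"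
      using g(1,3)[OF K] restrict_ident[OF b] by auto
  next
    fix f h k assume K: "K f h" and k: "K k (fst (PC f h))"
    note cs = bicovering_cospan[OF K]
    note P = CP.pullback_homs[OF CP.pullback[OF cs]]
    have K': "K (f \<cdot>\<^bsub>C\<^esub> k) h"
      using bicovering_comp[OF K CP.pullback[OF cs] k] .
    have "Cod C (f \<cdot>\<^bsub>C\<^esub> k) = Cod C f"
      using bicovering_cospan[OF K'] cs by (simp add: cospan_def)
    then have gk: "g (f \<cdot>\<^bsub>C\<^esub> k) h \<in> hom D (matching (f \<cdot>\<^bsub>C\<^esub> k) h) (on_obj \<Gamma> (Cod C f))"
      using g(1)[OF K'] by simp
    note r = restriction[OF cs]
    note m = DP.comp_hom[OF gk r(1)]
    have "proj1 f h \<cdot>\<^bsub>D\<^esub> (restriction f h \<cdot>\<^bsub>D\<^esub> g (f \<cdot>\<^bsub>C\<^esub> k) h) = on_arr \<Gamma> f \<cdot>\<^bsub>D\<^esub> g (f \<cdot>\<^bsub>C\<^esub> k) h"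
      "proj2 f h \<cdot>\<^bsub>D\<^esub> (restriction f h \<cdot>\<^bsub>D\<^esub> g (f \<cdot>\<^bsub>C\<^esub> k) h) = on_arr \<Gamma> h \<cdot>\<^bsub>D\<^esub> g (f \<cdot>\<^bsub>C\<^esub> k) h"
      using DP.comp_assoc[OF gk r(1) proj_hom(1)[OF cs]]
        DP.comp_assoc[OF gk r(1) proj_hom(2)[OF cs]] r(2,3) by simp_all
    then show "g f h \<cdot>\<^bsub>D\<^esub> (restriction f h \<cdot>\<^bsub>D\<^esub> g (f \<cdot>\<^bsub>C\<^esub> k) h) = g (f \<cdot>\<^bsub>C\<^esub> k) h"
      using ext[OF K DP.comp_hom[OF m g(1)[OF K]] gk] g'[OF K m] by simp
  next
    fix f' h' f h qa qb qc
    assume K': "K f' h'" and K: "K f h"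
      and "bicovering_morphism C PC (f', h') (f, h) qa qb qc"
    then have qa: "qa \<in> hom C (Dom C f') (Dom C f)" and qb: "qb \<in> hom C (Dom C h') (Dom C h)"
      and qc: "qc \<in> hom C (Cod C f') (Cod C f)"
      and sq: "f \<cdot>\<^bsub>C\<^esub> qa = qc \<cdot>\<^bsub>C\<^esub> f'" "h \<cdot>\<^bsub>C\<^esub> qb = qc \<cdot>\<^bsub>C\<^esub> h'"
      by (auto simp: bicovering_morphism_def)
    note cs = bicovering_cospan[OF K] and cs' = bicovering_cospan[OF K']
    note F = arrs[OF K] and F' = arrs[OF K'] and q = proj_hom[OF cs]
    note R = CP.pullback_homs[OF CP.pullback[OF cs']]
    let ?x = "on_arr \<Gamma> qa \<cdot>\<^bsub>D\<^esub> proj1 f h" and ?y = "on_arr \<Gamma> qb \<cdot>\<^bsub>D\<^esub> proj2 f h"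
    let ?m = "induced D (proj f' h') ?x ?y"
    have x: "?x \<in> hom D (matching f h) (on_obj \<Gamma> (Dom C f'))"
      and y: "?y \<in> hom D (matching f h) (on_obj \<Gamma> (Dom C h'))"
      using DP.comp_hom q restrict_hom[OF qa] restrict_hom[OF qb] by blast+
    have "f \<cdot>\<^bsub>C\<^esub> (qa \<cdot>\<^bsub>C\<^esub> fst (PC f' h')) = h \<cdot>\<^bsub>C\<^esub> (qb \<cdot>\<^bsub>C\<^esub> snd (PC f' h'))"
      using CP.comp_assoc[OF R(1) qa F(1)] CP.comp_assoc[OF R(2) qb F(2)]
        CP.comp_assoc[OF R(1) F'(1) qc] CP.comp_assoc[OF R(2) F'(2) qc] R(5) sq by simp
    then have "on_arr \<Gamma> (fst (PC f' h')) \<cdot>\<^bsub>D\<^esub> ?x = on_arr \<Gamma> (snd (PC f' h')) \<cdot>\<^bsub>D\<^esub> ?y"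
      using proj_agree[OF cs CP.comp_hom[OF R(1) qa] CP.comp_hom[OF R(2) qb]]
        restrict_restrict[OF R(1) qa q(1)] restrict_restrict[OF R(2) qb q(2)] by simp
    note m = induced_proj[OF cs' x y this]
    have "on_arr \<Gamma> f' \<cdot>\<^bsub>D\<^esub> (on_arr \<Gamma> qc \<cdot>\<^bsub>D\<^esub> g f h) = ?x"
      using restrict_restrict[OF F'(1) qc g(1)[OF K]] restrict_restrict[OF qa F(1) g(1)[OF K]]
        sq g(2)[OF K] by simp
    moreover have "on_arr \<Gamma> h' \<cdot>\<^bsub>D\<^esub> (on_arr \<Gamma> qc \<cdot>\<^bsub>D\<^esub> g f h) = ?y"
      using restrict_restrict[OF F'(2) qc g(1)[OF K]] restrict_restrict[OF qb F(2) g(1)[OF K]]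
        sq g(3)[OF K] by simp
    ultimately show "on_arr \<Gamma> qc \<cdot>\<^bsub>D\<^esub> g f h = g f' h' \<cdot>\<^bsub>D\<^esub> ?m"
      using ext[OF K' DP.comp_hom[OF g(1)[OF K] restrict_hom[OF qc]]
          DP.comp_hom[OF m(1) g(1)[OF K']]] g'[OF K' m(1)] m(2,3) by simp
  qed
  moreover have "g' = g" if "gleaf C PC D PD K \<Gamma> g'" for g'
  proof -
    interpret G: gleaf C PC D PD K \<Gamma> g' by fact
    have "g' f h = g f h" for f h
    proof (cases "K f h")
      case K: True
      show ?thesis
        using ext[OF K G.glue_hom[OF K] g(1)[OF K]] G.restrict_glue1[OF K] G.restrict_glue2[OF K]
          g(2,3)[OF K] by simp
    next
      case False
      then show ?thesis
        using G.extensional by (simp add: g_def)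
    qed
    then show ?thesis
      by blast
  qed
  ultimately show ?thesis
    by blast
qed


section \<open>Sheaves turn bicovering squares into pullback squares\<close>

text \<open>
  The members of the generated sieve carry a cone determined by its values at the two legs, so the
  universal property of the limit over the sieve specialises to that of the square.
\<close>

lemma sheaf_square_is_pullback:
  assumes "sheaf C J D \<Gamma>" and K: "covering_cospan C J f h"
  shows "is_pullback D (on_arr \<Gamma> (fst (PC f h))) (on_arr \<Gamma> (snd (PC f h)))
    (on_arr \<Gamma> f) (on_arr \<Gamma> h)"
proof -
  interpret S: sheaf C J D \<Gamma> by fact
  define S where "S = generated_sieve C {f, h}"
  define c where "c = Cod C f"
  have cs: "cospan C f h" and mf: "is_mono C f" and mh: "is_mono C h" and SJ: "S \<in> J c"
    using K by (auto simp: covering_cospan_def S_def c_def)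
  note P = CP.pullback_homs[OF CP.pullback[OF cs]]
  have f: "f \<in> hom C (Dom C f) c" and h: "h \<in> hom C (Dom C h) c"
    using P by (simp_all add: c_def)
  have c: "c \<in> Obj C"
    using f CP.cod_obj by (auto simp: hom_def)
  have legs: "f \<in> S" "h \<in> S"
    using CP.generated_sieve_legs[OF cs] by (simp_all add: S_def)
  have sieve: "is_sieve C c S"
    using S.sieve[OF c SJ] .
  have limit: "is_limit (op_cat (sieve_cat C S)) D (sieve_diagram C \<Gamma>) (on_obj \<Gamma> c) (on_arr \<Gamma>)"
    using S.restriction_limit[OF c SJ] .
  have cone_iff: "is_cone (op_cat (sieve_cat C S)) D (sieve_diagram C \<Gamma>) z \<rho> \<longleftrightarrow> z \<in> Obj D \<and>
      (\<forall>s \<in> S. \<rho> s \<in> hom D z (on_obj \<Gamma> (Dom C s))) \<and>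
      (\<forall>s t u. s \<in> S \<and> t \<in> S \<and> u \<in> hom C (Dom C s) (Dom C t) \<and> t \<cdot>\<^bsub>C\<^esub> u = s
        \<longrightarrow> on_arr \<Gamma> u \<cdot>\<^bsub>D\<^esub> \<rho> t = \<rho> s)" for z \<rho>
    by (auto simp: is_cone_def op_cat_def sieve_cat_def sieve_diagram_def)
  have "\<exists>!w. w \<in> hom D z (on_obj \<Gamma> c) \<and> on_arr \<Gamma> f \<cdot>\<^bsub>D\<^esub> w = x \<and> on_arr \<Gamma> h \<cdot>\<^bsub>D\<^esub> w = y"
    if x: "x \<in> hom D z (on_obj \<Gamma> (Dom C f))" and y: "y \<in> hom D z (on_obj \<Gamma> (Dom C h))"
      and agree: "on_arr \<Gamma> (fst (PC f h)) \<cdot>\<^bsub>D\<^esub> x = on_arr \<Gamma> (snd (PC f h)) \<cdot>\<^bsub>D\<^esub> y" for z x y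
  proof -
    \<comment> \<open>The value of the cone at \<open>s\<close>, as a relation: \<open>s\<close> may factor through both legs, and choosing
        one would make compatibility of the cone depend on the choices.\<close>
    define \<sigma> where "\<sigma> s e \<longleftrightarrow>
      (\<exists>u \<in> hom C (Dom C s) (Dom C f). s = f \<cdot>\<^bsub>C\<^esub> u \<and> e = on_arr \<Gamma> u \<cdot>\<^bsub>D\<^esub> x) \<or>
      (\<exists>v \<in> hom C (Dom C s) (Dom C h). s = h \<cdot>\<^bsub>C\<^esub> v \<and> e = on_arr \<Gamma> v \<cdot>\<^bsub>D\<^esub> y)" for s e
    have unique: "e = e'" if "\<sigma> s e" "\<sigma> s e'" for s e e'
      using that agree_on_square[OF cs _ _ _ x y agree] CP.mono_cancel[OF mf] CP.mono_cancel[OF mh]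
      unfolding \<sigma>_def by metis
    have exists: "\<exists>e. \<sigma> s e" if "s \<in> S" for s
    proof -
      from that obtain u where u: "u \<in> Arr C"
        "Cod C u = Dom C f \<and> s = f \<cdot>\<^bsub>C\<^esub> u \<or> Cod C u = Dom C h \<and> s = h \<cdot>\<^bsub>C\<^esub> u"
        unfolding S_def CP.generated_sieve_iff by blast
      moreover from this have "Dom C s = Dom C u"
        using f h CP.comp_arr[of u f] CP.comp_arr[of u h] by (auto simp: hom_def)
      ultimately show ?thesis
        unfolding \<sigma>_def by (auto simp: hom_def)
    qed
    define \<rho> where "\<rho> s = (SOME e. \<sigma> s e)" for s
    have \<rho>_\<sigma>: "\<sigma> s (\<rho> s)" if "s \<in> S" for s
      using exists[OF that] unfolding \<rho>_def by (rule someI_ex)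
    have \<rho>: "\<rho> s = e" if "s \<in> S" "\<sigma> s e" for s e
      using unique \<rho>_\<sigma> that by blast
    have hom: "e \<in> hom D z (on_obj \<Gamma> (Dom C s))" if "\<sigma> s e" for s e
      using that DP.comp_hom x y restrict_hom unfolding \<sigma>_def by blast
    have mult: "\<sigma> (t \<cdot>\<^bsub>C\<^esub> u) (on_arr \<Gamma> u \<cdot>\<^bsub>D\<^esub> e)"
      if e: "\<sigma> t e" and u: "u \<in> hom C (Dom C (t \<cdot>\<^bsub>C\<^esub> u)) (Dom C t)" for t u e
      using e[unfolded \<sigma>_def]
    proof (elim disjE bexE conjE)
      fix v assume v: "v \<in> hom C (Dom C t) (Dom C f)" "t = f \<cdot>\<^bsub>C\<^esub> v" "e = on_arr \<Gamma> v \<cdot>\<^bsub>D\<^esub> x"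
      have "t \<cdot>\<^bsub>C\<^esub> u = f \<cdot>\<^bsub>C\<^esub> (v \<cdot>\<^bsub>C\<^esub> u)" "on_arr \<Gamma> u \<cdot>\<^bsub>D\<^esub> e = on_arr \<Gamma> (v \<cdot>\<^bsub>C\<^esub> u) \<cdot>\<^bsub>D\<^esub> x"
        using CP.comp_assoc[OF u v(1) f] restrict_restrict[OF u v(1) x] v(2,3) by simp_all
      then show ?thesis
        using CP.comp_hom[OF u v(1)] unfolding \<sigma>_def by blast
    next
      fix v assume v: "v \<in> hom C (Dom C t) (Dom C h)" "t = h \<cdot>\<^bsub>C\<^esub> v" "e = on_arr \<Gamma> v \<cdot>\<^bsub>D\<^esub> y"
      have "t \<cdot>\<^bsub>C\<^esub> u = h \<cdot>\<^bsub>C\<^esub> (v \<cdot>\<^bsub>C\<^esub> u)" "on_arr \<Gamma> u \<cdot>\<^bsub>D\<^esub> e = on_arr \<Gamma> (v \<cdot>\<^bsub>C\<^esub> u) \<cdot>\<^bsub>D\<^esub> y"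
        using CP.comp_assoc[OF u v(1) h] restrict_restrict[OF u v(1) y] v(2,3) by simp_all
      then show ?thesis
        using CP.comp_hom[OF u v(1)] unfolding \<sigma>_def by blast
    qed
    have "z \<in> Obj D"
      using x DP.dom_obj by (auto simp: hom_def)
    then have "is_cone (op_cat (sieve_cat C S)) D (sieve_diagram C \<Gamma>) z \<rho>"
      unfolding cone_iff using \<rho> \<rho>_\<sigma> hom mult by metis
    then have lim: "\<exists>!w. w \<in> hom D z (on_obj \<Gamma> c) \<and> (\<forall>s \<in> S. on_arr \<Gamma> s \<cdot>\<^bsub>D\<^esub> w = \<rho> s)"
      using limit by (simp add: is_limit_def op_cat_def sieve_cat_def)
    have a: "Dom C f \<in> Obj C" "Dom C h \<in> Obj C"
      using f h CP.dom_obj by (auto simp: hom_def)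
    have "\<sigma> f x" "\<sigma> h y"
      using CP.ident_hom a CP.ident_right[OF f] CP.ident_right[OF h]
        restrict_ident[OF a(1) x] restrict_ident[OF a(2) y] unfolding \<sigma>_def by metis+
    then have \<rho>_legs: "\<rho> f = x" "\<rho> h = y"
      using \<rho> legs by blast+
    have "(\<forall>s \<in> S. on_arr \<Gamma> s \<cdot>\<^bsub>D\<^esub> w = \<rho> s) \<longleftrightarrow> on_arr \<Gamma> f \<cdot>\<^bsub>D\<^esub> w = x \<and> on_arr \<Gamma> h \<cdot>\<^bsub>D\<^esub> w = y"
      if w: "w \<in> hom D z (on_obj \<Gamma> c)" for w
    proof
      assume "\<forall>s \<in> S. on_arr \<Gamma> s \<cdot>\<^bsub>D\<^esub> w = \<rho> s"
      then show "on_arr \<Gamma> f \<cdot>\<^bsub>D\<^esub> w = x \<and> on_arr \<Gamma> h \<cdot>\<^bsub>D\<^esub> w = y"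
        using legs \<rho>_legs by auto
    next
      assume e: "on_arr \<Gamma> f \<cdot>\<^bsub>D\<^esub> w = x \<and> on_arr \<Gamma> h \<cdot>\<^bsub>D\<^esub> w = y"
      show "\<forall>s \<in> S. on_arr \<Gamma> s \<cdot>\<^bsub>D\<^esub> w = \<rho> s"
      proof
        fix s assume "s \<in> S"
        from \<rho>_\<sigma>[OF this] show "on_arr \<Gamma> s \<cdot>\<^bsub>D\<^esub> w = \<rho> s"
          unfolding \<sigma>_def using restrict_restrict[OF _ f w] restrict_restrict[OF _ h w] e by auto
      qed
    qed
    then show ?thesis
      using lim by (simp cong: conj_cong)
  qed
  moreover have "on_arr \<Gamma> (fst (PC f h)) \<cdot>\<^bsub>D\<^esub> on_arr \<Gamma> f = on_arr \<Gamma> (snd (PC f h)) \<cdot>\<^bsub>D\<^esub> on_arr \<Gamma> h"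
    using restrict_comp[OF P(1,3)] restrict_comp[OF P(2,4)] P(5) by simp
  ultimately show ?thesis
    using restrict_hom[OF P(1)] restrict_hom[OF P(2)] restrict_hom[OF f] restrict_hom[OF h]
    unfolding is_pullback_def cospan_def by (simp add: hom_def)
qed

end

theorem theorem4p3p7:
  fixes C :: "('oc, 'mc) cat" and J :: "'oc \<Rightarrow> 'mc set set"
    and D :: "('od, 'md) cat" and \<Gamma> :: "('oc, 'mc, 'od, 'md) functor_data"
    and PC :: "'mc \<Rightarrow> 'mc \<Rightarrow> 'mc \<times> 'mc" and PD :: "'md \<Rightarrow> 'md \<Rightarrow> 'md \<times> 'md"
  assumes "site C J"
    and "category_with_pullbacks C PC"
    and "category_with_pullbacks D PD"
    and "sheaf C J D \<Gamma>"
  shows "\<exists>!g. gleaf C PC D PD (covering_cospan C J) \<Gamma> g"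
proof -
  interpret gluing_context C PC D PD "covering_cospan C J" \<Gamma>
    using assms site.bicovering_system_covering_cospan[OF assms(1,2)]
    by (intro gluing_context.intro sheaf.axioms(2))
  show ?thesis
    using ex1_gleaf_if_squares_are_pullbacks sheaf_square_is_pullback[OF assms(4)] by blast
qed

end
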